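(* Let $n\ge 1$ and let $R\in\mathcal{R}$ be a nondegenerate convex reflector in $\mathbb{R}^{n+1}$. Then the support function $h$ of $R$ is positive and of class $C^1(S^n)$, and $R$ can be represented as $$X(u)=h(u)u+\nabla h(u),\qquad u\in S^n,$$ where $\nabla$ denotes the gradient in the standard metric of $S^n$.
   Context: Fix the origin $\mathcal{O}$ of $\mathbb{R}^{n+1}$, $n\ge 1$; $S^n$ is the unit sphere centered at $\mathcal{O}$. Paraboloids: "paraboloid" always means a paraboloid of revolution with focus $\mathcal{O}$ and axis direction $y\in S^n$ pointing towards its opening. It is denoted $P(y)$; its polar equation is $\rho_y(x)=\tilde p/(1-\langle x,y\rangle)$, $x\in S^n\setminus\{y\}$, where $\tilde p\ge 0$ is its focal parameter. Equivalently, $P(y)=\{X\in\mathbb{R}^{n+1}: |X|-\langle X,y\rangle=\tilde p\}$. $B(y)=\{X: |X|-\langle X,y\rangle\le\tilde p\}$ is the closed convex set bounded by $P(y)$ and containing its axis. If $\tilde p=0$ the paraboloid is degenerate (the ray from $\mathcal{O}$ in direction $y$); if $\tilde p=\infty$ it is improper and $B(y)=\mathbb{R}^{n+1}$. Reflectors: given a family $\{P(y): y\in S^n\}$ (one paraboloid for each $y$, with focal parameters $\tilde p(y)\in[0,\infty]$), put $B=\bigcap_{y\in S^n}B(y)$ and $R=\partial B$. If $B$ is compact with nonempty interior in $\mathbb{R}^{n+1}$, then $R$ is called a (nondegenerate) convex reflector with light source $\mathcal{O}$. The set of all nondegenerate convex reflectors with light source $\mathcal{O}$ is denoted $\mathcal{R}$.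 For $R\in\mathcal{R}$, $B(R)$ denotes the compact convex body bounded by $R$. The support function of $R$ is $h(u)=\sup_{X\in B(R)}\langle X,u\rangle$, $u\in S^n$. *)

theory Defs
  imports "HOL-Analysis.Analysis"
begin

text \<open>
  The ambient space \<open>\<real>\<^sup>n\<^sup>+\<^sup>1\<close> is a type of class \<open>euclidean_space\<close>, the fixed origin is \<open>0\<close>,
  and \<open>S\<^sup>n\<close> is \<open>sphere 0 1\<close>.
\<close>

section \<open>Reflectors\<close>

text \<open>
  The body bounded by the paraboloid of revolution with focus \<open>0\<close>, axis direction \<open>y\<close> and
  focal parameter \<open>p \<in> [0, \<infinity>]\<close>. As \<open>norm X - X \<bullet> y \<ge> 0\<close> for unit \<open>y\<close>, the embedding
  \<open>ennreal\<close> truncates nothing there. For \<open>p = 0\<close> the body is the ray from \<open>0\<close> in direction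
  \<open>y\<close> (degenerate case), for \<open>p = \<infinity>\<close> it is the whole space (improper case).
\<close>

definition paraboloid_body :: "'a::euclidean_space \<Rightarrow> ennreal \<Rightarrow> 'a set" where
  "paraboloid_body y p = {X. ennreal (norm X - X \<bullet> y) \<le> p}"

definition paraboloid_family_body :: "('a::euclidean_space \<Rightarrow> ennreal) \<Rightarrow> 'a set" where
  "paraboloid_family_body p = (\<Inter>y\<in>sphere 0 1. paraboloid_body y (p y))"

definition convex_reflectors :: "'a::euclidean_space set set" where
  "convex_reflectors =
     {R. \<exists>p. compact (paraboloid_family_body p) \<and>
             interior (paraboloid_family_body p) \<noteq> {} \<and>
             R = frontier (paraboloid_family_body p)}"

definition bounded_body :: "'a::euclidean_space set \<Rightarrow> 'a set" where
  "bounded_body R = (THE K. compact K \<and> convex K \<and> interior K \<noteq> {} \<and> frontier K = R)"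

definition reflector_support :: "'a::euclidean_space set \<Rightarrow> 'a \<Rightarrow> real" where
  "reflector_support R u = (SUP X\<in>bounded_body R. X \<bullet> u)"

lemma paraboloid_body_zero:
  assumes "norm y = 1"
  shows "paraboloid_body y 0 = {t *\<^sub>R y |t. 0 \<le> t}"
proof (intro equalityI subsetI)
  fix X assume "X \<in> paraboloid_body y 0"
  then have "norm X \<le> X \<bullet> y"
    by (simp add: paraboloid_body_def ennreal_eq_0_iff)
  moreover have "X \<bullet> y \<le> norm X"
    using norm_cauchy_schwarz[of X y] assms by simp
  ultimately have "X \<bullet> y = norm X * norm y"
    using assms by simp
  then have "norm X *\<^sub>R y = norm y *\<^sub>R X"
    using norm_cauchy_schwarz_eq by blast
  then have "X = norm X *\<^sub>R y"
    using assms by simp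
  then show "X \<in> {t *\<^sub>R y |t. 0 \<le> t}"
    using norm_ge_zero by blast
next
  fix X assume "X \<in> {t *\<^sub>R y |t. 0 \<le> t}"
  then show "X \<in> paraboloid_body y 0"
    using assms by (auto simp: paraboloid_body_def dot_square_norm)
qed

lemma paraboloid_body_top: "paraboloid_body y top = UNIV"
  by (simp add: paraboloid_body_def)

lemma paraboloid_body_ennreal:
  assumes "0 \<le> p"
  shows "paraboloid_body y (ennreal p) = {X. norm X - X \<bullet> y \<le> p}"
  using assms by (simp add: paraboloid_body_def)

lemma convex_paraboloid_body: "convex (paraboloid_body (y::'a::euclidean_space) p)"
proof (cases p)
  case (real r)
  have "convex {X. norm X - X \<bullet> y \<le> r}"
    unfolding convex_alt
  proof (clarsimp)
    fix X Z :: 'a and t :: real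
    assume X: "norm X - X \<bullet> y \<le> r" and Z: "norm Z - Z \<bullet> y \<le> r" and t: "0 \<le> t" "t \<le> 1"
    have "norm ((1 - t) *\<^sub>R X + t *\<^sub>R Z) \<le> (1 - t) * norm X + t * norm Z"
      using norm_triangle_ineq[of "(1 - t) *\<^sub>R X" "t *\<^sub>R Z"] t by simp
    then have "norm ((1 - t) *\<^sub>R X + t *\<^sub>R Z) - ((1 - t) *\<^sub>R X + t *\<^sub>R Z) \<bullet> y
        \<le> (1 - t) * (norm X - X \<bullet> y) + t * (norm Z - Z \<bullet> y)"
      by (simp add: inner_add_left algebra_simps)
    also have "\<dots> \<le> r"
      using X Z t by (intro convex_bound_le) auto
    finally show "norm ((1 - t) *\<^sub>R X + t *\<^sub>R Z) - ((1 - t) *\<^sub>R X + t *\<^sub>R Z) \<bullet> y \<le> r" .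
  qed
  then show ?thesis
    using real by (simp add: paraboloid_body_ennreal)
next
  case top
  then show ?thesis
    by (simp add: paraboloid_body_top)
qed

lemma convex_paraboloid_family_body: "convex (paraboloid_family_body p)"
  unfolding paraboloid_family_body_def by (intro convex_INT convex_paraboloid_body)

text \<open>A compact convex body is determined by its boundary.\<close>

lemma bounded_body_frontier:
  assumes "compact K" "convex K" "interior K \<noteq> {}"
  shows "bounded_body (frontier K) = K"
  unfolding bounded_body_def
proof (rule the_equality)
  show "compact K \<and> convex K \<and> interior K \<noteq> {} \<and> frontier K = frontier K"
    using assms by simp
next
  fix L assume "compact L \<and> convex L \<and> interior L \<noteq> {} \<and> frontier L = frontier K"
  then show "L = K"
    using Krein_Milman_frontier assms by metis
qed


section \<open>Gradient and class \<open>C\<^sup>1\<close> on the unit sphere\<close>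

text \<open>
  The sphere carries the metric induced from the ambient space, with tangent space
  \<open>{w. w \<bullet> u = 0}\<close> at \<open>u\<close>. A derivative within the sphere is determined only on the tangent
  space, where it is the differential of \<open>f\<close>; the gradient is the tangent vector representing
  that differential.
\<close>

definition has_sphere_gradient :: "('a::euclidean_space \<Rightarrow> real) \<Rightarrow> 'a \<Rightarrow> 'a \<Rightarrow> bool" where
  "has_sphere_gradient f v u \<longleftrightarrow>
     v \<bullet> u = 0 \<and>
     (\<exists>D. (f has_derivative D) (at u within sphere 0 1) \<and>
          (\<forall>w. w \<bullet> u = 0 \<longrightarrow> D w = v \<bullet> w))"

definition sphere_gradient :: "('a::euclidean_space \<Rightarrow> real) \<Rightarrow> 'a \<Rightarrow> 'a" where
  "sphere_gradient f u = (THE v. has_sphere_gradient f v u)"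

definition C1_on_sphere :: "('a::euclidean_space \<Rightarrow> real) \<Rightarrow> bool" where
  "C1_on_sphere f \<longleftrightarrow>
     (\<forall>u\<in>sphere 0 1. f differentiable (at u within sphere 0 1)) \<and>
     continuous_on (sphere 0 1) (sphere_gradient f)"

lemma differential_on_sphere_unique:
  fixes f :: "'a::euclidean_space \<Rightarrow> real"
  assumes u: "u \<in> sphere 0 1"
    and D: "(f has_derivative D) (at u within sphere 0 1)"
    and E: "(f has_derivative E) (at u within sphere 0 1)"
    and w: "w \<bullet> u = 0"
  shows "D w = E w"
proof (cases "w = 0")
  case True
  then show ?thesis
    using D E by (simp add: linear_0 has_derivative_linear)
next
  case False
  define w' where "w' = w /\<^sub>R norm w"
  define c where "c = (\<lambda>t::real. cos t *\<^sub>R u + sin t *\<^sub>R w')"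
  have uu: "u \<bullet> u = 1" and ww: "w' \<bullet> w' = 1" and uw: "u \<bullet> w' = 0" "w' \<bullet> u = 0"
    using u w False
    by (auto simp: w'_def dot_square_norm inner_commute power2_eq_square)
  have "c t \<bullet> c t = (cos t)\<^sup>2 + (sin t)\<^sup>2" for t
    by (simp add: c_def inner_add_left inner_add_right uu ww uw power2_eq_square)
  then have c_sphere: "c t \<in> sphere 0 1" for t
    by (simp add: norm_eq_sqrt_inner)
  have c0: "c 0 = u"
    by (simp add: c_def)
  have dc: "(c has_derivative (\<lambda>t. t *\<^sub>R w')) (at 0)"
    unfolding c_def by (auto intro!: derivative_eq_intros)
  have along: "((\<lambda>t. f (c t)) has_derivative (\<lambda>t. G (t *\<^sub>R w'))) (at 0)"
    if "(f has_derivative G) (at u within sphere 0 1)" for G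
  proof (rule has_derivative_in_compose[OF dc])
    show "(f has_derivative G) (at (c 0) within range c)"
      using that c_sphere by (auto simp: c0 intro: has_derivative_subset)
  qed
  have "(\<lambda>t. D (t *\<^sub>R w')) = (\<lambda>t. E (t *\<^sub>R w'))"
    using along[OF D] along[OF E] by (rule has_derivative_unique)
  then have "D (norm w *\<^sub>R w') = E (norm w *\<^sub>R w')"
    by (rule fun_cong)
  then show ?thesis
    using False by (simp add: w'_def)
qed

lemma has_sphere_gradient_unique:
  assumes "u \<in> sphere 0 1" "has_sphere_gradient f v u" "has_sphere_gradient f v' u"
  shows "v = v'"
proof -
  have t: "(v - v') \<bullet> u = 0"
    using assms by (simp add: has_sphere_gradient_def inner_diff_left)
  then have "v \<bullet> (v - v') = v' \<bullet> (v - v')"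
    using assms differential_on_sphere_unique unfolding has_sphere_gradient_def by metis
  then have "(v - v') \<bullet> (v - v') = 0"
    by (simp add: inner_diff_left)
  then show ?thesis
    by simp
qed

lemma sphere_gradient_eq:
  assumes "u \<in> sphere 0 1" "has_sphere_gradient f v u"
  shows "sphere_gradient f u = v"
  unfolding sphere_gradient_def
  using assms has_sphere_gradient_unique by blast

lemma has_sphere_gradient_sphere_gradient:
  fixes f :: "'a::euclidean_space \<Rightarrow> real"
  assumes u: "u \<in> sphere 0 1" and f: "f differentiable (at u within sphere 0 1)"
  shows "has_sphere_gradient f (sphere_gradient f u) u"
proof -
  obtain D where D: "(f has_derivative D) (at u within sphere 0 1)"
    using f by (auto simp: differentiable_def)
  define a where "a = (\<Sum>b\<in>Basis. D b *\<^sub>R b)"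
  have lin: "linear D"
    using D has_derivative_linear by blast
  have Da: "D w = a \<bullet> w" for w
  proof -
    have "D w = D (\<Sum>b\<in>Basis. (w \<bullet> b) *\<^sub>R b)"
      by (simp add: euclidean_representation)
    also have "\<dots> = (\<Sum>b\<in>Basis. (w \<bullet> b) * D b)"
      by (simp add: linear_sum[OF lin] linear_cmul[OF lin])
    also have "\<dots> = a \<bullet> w"
      by (simp add: a_def inner_sum_left inner_commute[of w] mult.commute)
    finally show ?thesis .
  qed
  define v where "v = a - (a \<bullet> u) *\<^sub>R u"
  have "u \<bullet> u = 1"
    using u by (simp add: dot_square_norm)
  then have "v \<bullet> u = 0"
    by (simp add: v_def inner_diff_left)
  moreover have "D w = v \<bullet> w" if "w \<bullet> u = 0" for w
  proof -
    have "u \<bullet> w = 0"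
      using that inner_commute[of u w] by simp
    then show ?thesis
      by (simp add: Da v_def inner_diff_left)
  qed
  ultimately have "has_sphere_gradient f v u"
    using D unfolding has_sphere_gradient_def by blast
  then show ?thesis
    using sphere_gradient_eq[OF u] by metis
qed

end

theory Submission
  imports Defs
begin

text \<open>
  Write \<open>f\<^sub>y(X) = \<bar>X\<bar> - \<langle>X, y\<rangle>\<close>. Every point \<open>Z\<close> of the body \<open>B\<close> bounds the focal parameters from
  below, \<open>f\<^sub>y(Z) \<le> p(y)\<close>, so by compactness of the sphere a point \<open>X\<close> is interior to \<open>B\<close> as soon as
  each \<open>f\<^sub>y(X)\<close> is strictly exceeded by some \<open>f\<^sub>y(Z)\<close>. As \<open>B\<close> is not contained in a ray, this applies to
  \<open>X = 0\<close>, whence \<open>h > 0\<close>; and as \<open>f\<^sub>y\<close> is convex, affine only along rays from \<open>0\<close> and there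
  homogeneous, it applies to the midpoint of any two distinct points of \<open>B\<close>. So \<open>B\<close> is strictly
  convex, its support point \<open>X(u)\<close> is unique and depends continuously on \<open>u\<close>, and \<open>X(u)\<close> is the
  Euclidean gradient of \<open>h\<close> at \<open>u\<close>, with normal part \<open>h(u) u\<close>.
\<close>

section \<open>Support points of strictly convex bodies\<close>

locale strictly_convex_body =
  fixes K :: "'a::euclidean_space set"
  assumes compact: "compact K"
    and nonempty: "K \<noteq> {}"
    and convex: "convex K"
    and midpoint_in_interior: "\<lbrakk>A \<in> K; C \<in> K; A \<noteq> C\<rbrakk> \<Longrightarrow> midpoint A C \<in> interior K"
begin

definition support :: "'a \<Rightarrow> real" where
  "support u = (SUP X\<in>K. X \<bullet> u)"

definition support_point :: "'a \<Rightarrow> 'a" where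
  "support_point u = (SOME X. X \<in> K \<and> (\<forall>Z\<in>K. Z \<bullet> u \<le> X \<bullet> u))"

lemma support_point:
  shows support_point_in: "support_point u \<in> K"
    and inner_le_support_point: "Z \<in> K \<Longrightarrow> Z \<bullet> u \<le> support_point u \<bullet> u"
proof -
  have "\<exists>X\<in>K. \<forall>Z\<in>K. Z \<bullet> u \<le> X \<bullet> u"
    by (intro continuous_attains_sup compact nonempty continuous_intros)
  then have "\<exists>X. X \<in> K \<and> (\<forall>Z\<in>K. Z \<bullet> u \<le> X \<bullet> u)"
    by blast
  then have "support_point u \<in> K \<and> (\<forall>Z\<in>K. Z \<bullet> u \<le> support_point u \<bullet> u)"
    unfolding support_point_def by (rule someI_ex)
  then show "support_point u \<in> K" "Z \<in> K \<Longrightarrow> Z \<bullet> u \<le> support_point u \<bullet> u"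
    by blast+
qed

lemma support_eq: "support u = support_point u \<bullet> u"
  unfolding support_def
  using support_point by (intro cSup_eq_maximum) auto

text \<open>A small step from \<open>X\<close> in direction \<open>u\<close> stays in
  \<open>K\<close> and increases the inner product.\<close>

lemma inner_less_of_interior:
  assumes "X \<in> interior K" "u \<noteq> 0"
  shows "X \<bullet> u < support u"
proof -
  obtain e where e: "e > 0" "cball X e \<subseteq> K"
    using assms(1) mem_interior_cball by blast
  define Z where "Z = X + (e / norm u) *\<^sub>R u"
  have "Z \<in> K"
    using e assms(2) by (intro subsetD[OF e(2)]) (simp add: Z_def dist_norm)
  then have "Z \<bullet> u \<le> support u"
    using inner_le_support_point support_eq by simp
  moreover have "Z \<bullet> u = X \<bullet> u + e * norm u"
    using assms(2) by (simp add: Z_def inner_add_left dot_square_norm power2_eq_square)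
  ultimately show ?thesis
    using e assms(2) by (smt (verit) mult_pos_pos zero_less_norm_iff)
qed

text \<open>The midpoint of two distinct maximisers would be a maximiser in the interior.\<close>

lemma support_point_unique:
  assumes "X \<in> K" "u \<noteq> 0" "\<And>Z. Z \<in> K \<Longrightarrow> Z \<bullet> u \<le> X \<bullet> u"
  shows "X = support_point u"
proof (rule ccontr)
  assume "X \<noteq> support_point u"
  then have "midpoint X (support_point u) \<bullet> u < support u"
    using assms support_point_in midpoint_in_interior inner_less_of_interior by blast
  moreover have "X \<bullet> u = support_point u \<bullet> u"
    using assms support_point_in inner_le_support_point by (intro antisym) blast+
  ultimately show False
    by (simp add: support_eq midpoint_def inner_add_left)
qed

lemma continuous_on_support_point: "continuous_on (sphere 0 1) support_point"
proof (rule continuous_from_closed_graph[OF compact])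
  show "support_point \<in> sphere 0 1 \<rightarrow> K"
    using support_point_in by blast
  \<comment> \<open>By uniqueness the graph is described by maximality alone, a family of closed
    conditions on pairs. A closed graph with values in a compact set gives continuity.\<close>
  have "(\<lambda>u. (u, support_point u)) ` sphere 0 1 =
      (sphere 0 1 \<times> K) \<inter> (\<Inter>Z\<in>K. {q. Z \<bullet> fst q \<le> snd q \<bullet> fst q})" (is "?G = ?H")
  proof (intro equalityI subsetI)
    fix q assume "q \<in> ?G"
    then show "q \<in> ?H"
      using support_point by auto
  next
    fix q assume q: "q \<in> ?H"
    then have "fst q \<noteq> 0"
      by auto
    then have "snd q = support_point (fst q)"
      using q by (intro support_point_unique) auto
    then show "q \<in> ?G"
      using q by (auto intro!: image_eqI[of _ _ "fst q"] prod_eqI)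
  qed
  moreover have "closed ?H"
    by (intro closed_Int closed_Times closed_INT ballI closed_sphere compact_imp_closed[OF compact]
        closed_Collect_le continuous_intros)
  ultimately show "closed ?G"
    by simp
qed

text \<open>The remainder lies between 0, by maximality at \<open>v\<close>, and the inner product
  of \<open>support_point v - support_point u\<close> with \<open>v - u\<close>, by maximality at
  \<open>u\<close>. Continuity of \<open>support_point\<close> makes this bound small relative to
  \<open>norm (v - u)\<close>.\<close>

lemma support_has_derivative:
  assumes "u \<in> sphere 0 1"
  shows "(support has_derivative (\<lambda>w. support_point u \<bullet> w)) (at u within sphere 0 1)"
  unfolding has_derivative_within_alt
proof (intro conjI allI impI)
  show "bounded_linear (\<lambda>w. support_point u \<bullet> w)"
    by (rule bounded_linear_inner_right)
next
  fix e :: real assume "e > 0"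
  then obtain d where d: "d > 0"
    "\<And>v. v \<in> sphere 0 1 \<Longrightarrow> dist v u < d \<Longrightarrow> dist (support_point v) (support_point u) < e"
    using continuous_on_support_point assms unfolding continuous_on_iff by blast
  have "norm (support v - support u - support_point u \<bullet> (v - u)) \<le> e * norm (v - u)"
    if v: "v \<in> sphere 0 1" "norm (v - u) < d" for v
  proof -
    have "0 \<le> support v - support u - support_point u \<bullet> (v - u)"
      using inner_le_support_point[OF support_point_in, of u v]
      by (simp add: support_eq inner_diff_right)
    moreover have "support v - support u - support_point u \<bullet> (v - u)
        \<le> (support_point v - support_point u) \<bullet> (v - u)"
      using inner_le_support_point[OF support_point_in, of v u]
      by (simp add: support_eq inner_diff_right inner_diff_left)
    moreover have "\<dots> \<le> norm (support_point v - support_point u) * norm (v - u)"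
      by (rule norm_cauchy_schwarz)
    moreover have "\<dots> \<le> e * norm (v - u)"
      using d(2)[of v] v by (intro mult_right_mono) (auto simp: dist_norm)
    ultimately show ?thesis
      by simp
  qed
  then show "\<exists>d>0. \<forall>v\<in>sphere 0 1. norm (v - u) < d \<longrightarrow>
      norm (support v - support u - support_point u \<bullet> (v - u)) \<le> e * norm (v - u)"
    using d(1) by blast
qed

text \<open>The differential on the sphere sees only tangent vectors, so the component of
  \<open>support_point u\<close> along \<open>u\<close> is projected away.\<close>

lemma sphere_gradient_support:
  assumes "u \<in> sphere 0 1"
  shows "sphere_gradient support u = support_point u - support u *\<^sub>R u"
proof (rule sphere_gradient_eq[OF assms])
  have "u \<bullet> u = 1"
    using assms by (simp add: dot_square_norm)
  then have "(support_point u - support u *\<^sub>R u) \<bullet> u = 0"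
    by (simp add: inner_diff_left support_eq)
  moreover have "support_point u \<bullet> w = (support_point u - support u *\<^sub>R u) \<bullet> w" if "w \<bullet> u = 0" for w
    using that inner_commute[of u w] by (simp add: inner_diff_left)
  ultimately show "has_sphere_gradient support (support_point u - support u *\<^sub>R u) u"
    unfolding has_sphere_gradient_def using support_has_derivative[OF assms] by blast
qed

lemma C1_on_sphere_support: "C1_on_sphere support"
  unfolding C1_on_sphere_def
proof (intro conjI ballI)
  fix u :: 'a assume "u \<in> sphere 0 1"
  then show "support differentiable (at u within sphere 0 1)"
    using support_has_derivative differentiableI by blast
next
  have "continuous_on (sphere 0 1) (\<lambda>u. support_point u - (support_point u \<bullet> u) *\<^sub>R u)"
    by (intro continuous_intros continuous_on_support_point)
  then show "continuous_on (sphere 0 1) (sphere_gradient support)"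
    by (rule continuous_on_eq) (simp add: sphere_gradient_support support_eq)
qed

lemma frontier_eq_support_points: "frontier K = support_point ` sphere 0 1"
proof (intro equalityI subsetI)
  fix X assume X: "X \<in> frontier K"
  then have "X \<in> K"
    using compact compact_imp_closed frontier_subset_closed by blast
  have "X \<notin> interior K"
    using X by (simp add: frontier_def)
  \<comment> \<open>If the interior is empty, \<open>K\<close> is a singleton and any nonzero
    \<open>a\<close> will do; otherwise \<open>X\<close> is a relative boundary point and has a
    supporting hyperplane.\<close>
  obtain a where a: "a \<noteq> 0" "\<And>Z. Z \<in> K \<Longrightarrow> a \<bullet> X \<le> a \<bullet> Z"
  proof (cases "interior K = {}")
    case True
    then have "K = {X}"
      using midpoint_in_interior \<open>X \<in> K\<close> by blast
    then show thesis
      using that[of "SOME b. b \<in> Basis"] nonzero_Basis[OF SOME_Basis] by simp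
  next
    case False
    then have "X \<notin> rel_interior K"
      using \<open>X \<notin> interior K\<close> rel_interior_nonempty_interior by blast
    then show thesis
      using supporting_hyperplane_rel_boundary[OF convex \<open>X \<in> K\<close>] that by metis
  qed
  \<comment> \<open>The sign turns the minimum of \<open>a\<close> at \<open>X\<close> into a
    maximum.\<close>
  define u where "u = - (a /\<^sub>R norm a)"
  have "u \<in> sphere 0 1"
    using a(1) by (simp add: u_def)
  moreover have "Z \<bullet> u \<le> X \<bullet> u" if "Z \<in> K" for Z
    using a(2)[OF that] by (simp add: u_def inner_commute[of _ a] mult_left_mono)
  then have "X = support_point u"
    using \<open>u \<in> sphere 0 1\<close> by (intro support_point_unique \<open>X \<in> K\<close>) auto
  ultimately show "X \<in> support_point ` sphere 0 1"
    by blast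
next
  fix X assume "X \<in> support_point ` sphere 0 1"
  then obtain u where u: "u \<in> sphere 0 1" "X = support_point u"
    by blast
  then have "X \<notin> interior K"
    using inner_less_of_interior[of X u] by (force simp: support_eq)
  then show "X \<in> frontier K"
    using u support_point_in closure_subset by (auto simp: frontier_def)
qed

end

section \<open>Strict convexity of reflectors\<close>

lemma paraboloid_family_body_iff:
  "X \<in> paraboloid_family_body p \<longleftrightarrow> (\<forall>y\<in>sphere 0 1. ennreal (norm X - X \<bullet> y) \<le> p y)"
  by (simp add: paraboloid_family_body_def paraboloid_body_def)

text \<open>Since \<open>p\<close> need not be continuous, it is replaced by the lower bounds
  \<open>norm Z - Z \<bullet> y\<close> with \<open>Z\<close> in the body, which are continuous in
  \<open>y\<close>.\<close>

lemma interior_paraboloid_family_bodyI: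
  fixes X :: "'a::euclidean_space"
  assumes X: "\<And>y. y \<in> sphere 0 1 \<Longrightarrow>
      \<exists>Z\<in>paraboloid_family_body p. norm X - X \<bullet> y < norm Z - Z \<bullet> y"
  shows "X \<in> interior (paraboloid_family_body p)"
proof (rule interiorI)
  let ?B = "paraboloid_family_body p"
  \<comment> \<open>\<open>T\<close> consists of the pairs \<open>(y, V)\<close> at which no point
    of the body exceeds \<open>V\<close>. It is closed, and projecting along the compact sphere
    keeps it closed, so the complement \<open>W\<close> is open.\<close>
  define T where
    "T = (\<Inter>Z\<in>?B. {q::'a \<times> 'a. norm Z - Z \<bullet> fst q \<le> norm (snd q) - snd q \<bullet> fst q})"
  define W where "W = - {V. \<exists>y. y \<in> sphere 0 1 \<and> (y, V) \<in> T}"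
  have "closed T"
    unfolding T_def by (intro closed_INT ballI closed_Collect_le continuous_intros)
  then show "open W"
    unfolding W_def by (intro open_Compl closed_compact_projection compact_sphere)
  show "X \<in> W"
    using X by (force simp: W_def T_def)
  show "W \<subseteq> ?B"
  proof
    fix V assume V: "V \<in> W"
    show "V \<in> ?B"
      unfolding paraboloid_family_body_iff
    proof
      fix y :: 'a assume y: "y \<in> sphere 0 1"
      obtain Z where Z: "Z \<in> ?B" "norm V - V \<bullet> y < norm Z - Z \<bullet> y"
        using V y by (force simp: W_def T_def not_le)
      then have "ennreal (norm V - V \<bullet> y) \<le> ennreal (norm Z - Z \<bullet> y)"
        by (simp add: ennreal_leI)
      also have "\<dots> \<le> p y"
        using Z(1) y by (simp add: paraboloid_family_body_iff)
      finally show "ennreal (norm V - V \<bullet> y) \<le> p y" .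
    qed
  qed
qed

text \<open>Otherwise the body lies in the degenerate paraboloid, hence in a line, which has empty
  interior in dimension at least 2.\<close>

lemma not_contained_in_ray:
  fixes B :: "'a::euclidean_space set"
  assumes "DIM('a) \<ge> 2" "interior B \<noteq> {}" "norm y = 1"
  shows "\<exists>Z\<in>B. 0 < norm Z - Z \<bullet> y"
proof (rule ccontr)
  assume "\<not> ?thesis"
  then have "B \<subseteq> paraboloid_body y 0"
    by (auto simp: paraboloid_body_def not_less ennreal_eq_0_iff)
  then have "B \<subseteq> span {y}"
    using paraboloid_body_zero[OF assms(3)] by (auto simp: span_singleton)
  then have "dim B \<le> 1"
    using dim_subset[of B "span {y}"] dim_le_card[of "span {y}" "{y}"] by simp
  then show False
    using empty_interior_lowdim[of B] assms by simp
qed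

lemma zero_in_interior_paraboloid_family_body:
  fixes p :: "'a::euclidean_space \<Rightarrow> ennreal"
  assumes "DIM('a) \<ge> 2" "interior (paraboloid_family_body p) \<noteq> {}"
  shows "0 \<in> interior (paraboloid_family_body p)"
  using not_contained_in_ray[OF assms] by (intro interior_paraboloid_family_bodyI) simp

text \<open>Equality in the triangle inequality puts \<open>A\<close> and \<open>C\<close> on one
  ray from the origin. There \<open>f\<close> is positively homogeneous, so equal positive values
  force equal norms.\<close>

lemma focal_parameter_midpoint_eq:
  fixes A C y :: "'a::euclidean_space"
  defines "f \<equiv> (\<lambda>X. norm X - X \<bullet> y)"
  assumes le: "f A \<le> f (midpoint A C)" "f C \<le> f (midpoint A C)" and pos: "0 < f (midpoint A C)"
  shows "A = C"
proof -
  have mid: "2 * f (midpoint A C) = norm (A + C) - (A \<bullet> y + C \<bullet> y)"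
    by (simp add: f_def midpoint_def inner_add_left) (simp add: field_simps)
  have "norm (A + C) \<le> norm A + norm C"
    by (rule norm_triangle_ineq)
  then have "norm (A + C) = norm A + norm C"
    and f: "f A = f (midpoint A C)" "f C = f (midpoint A C)"
    using le mid by (auto simp: f_def)
  then have parallel: "norm A *\<^sub>R C = norm C *\<^sub>R A"
    using norm_triangle_eq by blast
  then have "f (norm A *\<^sub>R C) = f (norm C *\<^sub>R A)"
    by simp
  then have "norm A * f C = norm C * f A"
    by (simp add: f_def algebra_simps)
  then have "norm A = norm C"
    using f pos by simp
  moreover have "A \<noteq> 0"
    using f pos by (auto simp: f_def)
  ultimately show ?thesis
    using parallel by auto
qed

lemma strictly_convex_paraboloid_family_body:
  fixes p :: "'a::euclidean_space \<Rightarrow> ennreal"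
  assumes "DIM('a) \<ge> 2" "compact (paraboloid_family_body p)"
    and "interior (paraboloid_family_body p) \<noteq> {}"
  shows "strictly_convex_body (paraboloid_family_body p)"
proof
  let ?B = "paraboloid_family_body p"
  show "compact ?B" "convex ?B"
    using assms convex_paraboloid_family_body by auto
  show "?B \<noteq> {}"
    using assms(3) by auto
  fix A C assume AC: "A \<in> ?B" "C \<in> ?B" "A \<noteq> C"
  show "midpoint A C \<in> interior ?B"
  proof (rule interior_paraboloid_family_bodyI, rule ccontr)
    fix y :: 'a
    assume y: "y \<in> sphere 0 1"
      and "\<not> (\<exists>Z\<in>?B. norm (midpoint A C) - midpoint A C \<bullet> y < norm Z - Z \<bullet> y)"
    then have le: "norm Z - Z \<bullet> y \<le> norm (midpoint A C) - midpoint A C \<bullet> y" if "Z \<in> ?B" for Z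
      using that by force
    \<comment> \<open>By \<open>le\<close> the midpoint attains the maximum over the body; a
      positive value somewhere makes this maximum positive.\<close>
    obtain Z where "Z \<in> ?B" "0 < norm Z - Z \<bullet> y"
      using not_contained_in_ray[OF assms(1,3), of y] y by auto
    then show False
      using focal_parameter_midpoint_eq[of A y C] le AC by force
  qed
qed

theorem theorem6:
  fixes n :: nat and R :: "'a::euclidean_space set"
  assumes "n \<ge> 1" and "DIM('a) = n + 1"
    and "R \<in> convex_reflectors"
  shows "(\<forall>u\<in>sphere 0 1. reflector_support R u > 0) \<and>
    C1_on_sphere (reflector_support R) \<and>
    R = (\<lambda>u. reflector_support R u *\<^sub>R u + sphere_gradient (reflector_support R) u) ` sphere 0 1"
proof -
  obtain p where p: "compact (paraboloid_family_body p)" "interior (paraboloid_family_body p) \<noteq> {}"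
    and R: "R = frontier (paraboloid_family_body p)"
    using assms(3) unfolding convex_reflectors_def by blast
  let ?B = "paraboloid_family_body p"
  have dim: "DIM('a) \<ge> 2"
    using assms by simp
  interpret strictly_convex_body ?B
    by (rule strictly_convex_paraboloid_family_body[OF dim p])
  have h: "reflector_support R = support"
    by (simp add: fun_eq_iff reflector_support_def support_def R
        bounded_body_frontier[OF p(1) convex p(2)])
  \<comment> \<open>The interior point 0 has inner product 0 with \<open>u\<close>, strictly below
    the support value.\<close>
  have "support u > 0" if "u \<in> sphere 0 1" for u
    using inner_less_of_interior[OF zero_in_interior_paraboloid_family_body[OF dim p(2)], of u] that
    by force
  \<comment> \<open>Adding \<open>support u *\<^sub>R u\<close> restores the normal component
    removed in the gradient.\<close>
  moreover have "(\<lambda>u. support u *\<^sub>R u + sphere_gradient support u) ` sphere 0 1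
      = support_point ` sphere 0 1"
    by (intro image_cong) (simp_all add: sphere_gradient_support)
  ultimately show ?thesis
    unfolding h using C1_on_sphere_support frontier_eq_support_points R by simp
qed

end
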